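(* There is a number $s_0\in(1/12,1/11)$ such that $L(a,b)\le\lambda_s(a,b)\le I(a,b)$ for all $a,b>0$ whenever $s_0\le s\le 1$. These bounds are best possible: the inequality $L(a,b)\le\lambda_s(a,b)$ holds for all $a,b>0$ if and only if $s\ge s_0$, and the inequality $\lambda_s(a,b)\le I(a,b)$ holds for all $a,b>0$ if and only if $s\le 1$.
   Context: For $a,b>0$ with $a\neq b$ define $$\lambda_s(a,b)=\begin{cases}\dfrac{s-1}{s+1}\cdot\dfrac{a^{s+1}+b^{s+1}-2\left(\frac{a+b}{2}\right)^{s+1}}{a^s+b^s-2\left(\frac{a+b}{2}\right)^s}, & s\in\mathbb{R}\setminus\{-1,0,1\},\\[3mm] \dfrac{2\log\frac{a+b}{2}-\log a-\log b}{\frac{1}{2a}+\frac{1}{2b}-\frac{2}{a+b}}, & s=-1,\\[3mm] \dfrac{a\log a+b\log b-(a+b)\log\frac{a+b}{2}}{2\log\frac{a+b}{2}-\log a-\log b}, & s=0,\\[3mm] \dfrac{(b-a)^2}{4\left(a\log a+b\log b-(a+b)\log\frac{a+b}{2}\right)}, & s=1,\end{cases}$$ and $\lambda_s(a,a)=a$. The logarithmic mean is $L(a,b)=\frac{b-a}{\log b-\log a}$ and the identric mean is $I(a,b)=\frac1e\,(b^b/a^a)^{1/(b-a)}$ for $a\ne b$, with $L(a,a)=I(a,a)=a$. *)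

theory Defs
  imports Complex_Main
begin

definition lambda_mean :: "real \<Rightarrow> real \<Rightarrow> real \<Rightarrow> real" where
  "lambda_mean s a b =
    (if a = b then a
     else if s = -1 then
       (2 * ln ((a + b) / 2) - ln a - ln b) / (1 / (2 * a) + 1 / (2 * b) - 2 / (a + b))
     else if s = 0 then
       (a * ln a + b * ln b - (a + b) * ln ((a + b) / 2)) / (2 * ln ((a + b) / 2) - ln a - ln b)
     else if s = 1 then
       (b - a)\<^sup>2 / (4 * (a * ln a + b * ln b - (a + b) * ln ((a + b) / 2)))
     else
       (s - 1) / (s + 1) *
       ((a powr (s + 1) + b powr (s + 1) - 2 * ((a + b) / 2) powr (s + 1)) /
        (a powr s + b powr s - 2 * ((a + b) / 2) powr s)))"

definition log_mean :: "real \<Rightarrow> real \<Rightarrow> real" where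
  "log_mean a b = (if a = b then a else (b - a) / (ln b - ln a))"

definition identric_mean :: "real \<Rightarrow> real \<Rightarrow> real" where
  "identric_mean a b = (if a = b then a
     else exp (-1) * ((b powr b / a powr a) powr (1 / (b - a))))"

end

theory Submission
  imports Defs "HOL-Analysis.Analysis" "HOL-Real_Asymp.Real_Asymp"
begin

text \<open>
  If \<open>f\<^sub>s\<close> has second derivative \<open>x powr (s - 2)\<close>, then \<open>lambda_mean s a b\<close> is the quotient of the midpoint
  convexity gaps of \<open>f\<^sub>s\<^sub>+\<^sub>1\<close> and \<open>f\<^sub>s\<close>. A convexity argument for a suitable combination of four such potentials shows that
  it increases with \<open>s\<close>. Hence \<open>s\<^sub>0\<close> can be taken as the infimum of the \<open>s\<close> for which the lower bound
  holds, and it is attained by continuity in \<open>s\<close>. The lower bound fails at \<open>s = 1/12\<close> for one explicit pair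
  \<open>(a, b)\<close>. At \<open>s = 909/10000 < 1/11\<close> it holds because, in \<open>u = t\<^sup>2\<close> with \<open>(a, b) = (1 - t, 1 + t)\<close>,
  it says that a power series is nonnegative on \<open>(0, 1)\<close>; all partial sums of the coefficients are nonnegative
  (the first 76 by integer arithmetic, the later coefficients being nonnegative themselves), and Abel summation applies.
  The upper bound at \<open>s = 1\<close> follows by repeated differentiation, and for \<open>s > 1\<close> it fails near \<open>a = b\<close>,
  where \<open>lambda_mean s (1 - t) (1 + t) = 1 + (s - 2) t\<^sup>2 / 6 + \<dots>\<close> and \<open>identric_mean (1 - t) (1 + t) = 1 - t\<^sup>2 / 6 + \<dots>\<close>.
\<close>

section \<open>Monotonicity in the parameter and homogeneity\<close>

text \<open>Normalised so that the second derivative is \<open>x powr (s - 2)\<close> for every \<open>s\<close>; the exceptional branches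
  of \<open>lambda_mean\<close> are exactly those of this potential at \<open>s\<close> and \<open>s + 1\<close>.\<close>

definition pot :: "real \<Rightarrow> real \<Rightarrow> real" where
  "pot s x = (if s = 0 then - ln x else if s = 1 then x * ln x else x powr s / (s * (s - 1)))"

definition pot' :: "real \<Rightarrow> real \<Rightarrow> real" where
  "pot' s x = (if s = 1 then ln x + 1 else x powr (s - 1) / (s - 1))"

definition mid_gap :: "(real \<Rightarrow> real) \<Rightarrow> real \<Rightarrow> real \<Rightarrow> real" where
  "mid_gap f a b = f a + f b - 2 * f ((a + b) / 2)"

lemma has_real_derivative_pot:
  assumes "0 < x"
  shows "(pot s has_real_derivative pot' s x) (at x)"
proof -
  consider "s = 0" | "s = 1" | "s \<noteq> 0" "s \<noteq> 1" by blast
  then show ?thesis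
  proof cases
    case 1
    have "pot s = (\<lambda>x. - ln x)" using 1 by (auto simp: pot_def)
    then show ?thesis using 1 assms
      by (auto intro!: derivative_eq_intros simp: pot'_def powr_minus field_simps)
  next
    case 2
    have "pot s = (\<lambda>x. x * ln x)" using 2 by (auto simp: pot_def)
    then show ?thesis using 2 assms
      by (auto intro!: derivative_eq_intros simp: pot'_def)
  next
    case 3
    have "pot s = (\<lambda>x. x powr s / (s * (s - 1)))" using 3 by (auto simp: pot_def)
    then show ?thesis using 3 assms
      by (auto intro!: derivative_eq_intros simp: pot'_def)
  qed
qed

lemma has_real_derivative_pot':
  assumes "0 < x"
  shows "(pot' s has_real_derivative x powr (s - 2)) (at x)"
proof (cases "s = 1")
  case True
  have "pot' s = (\<lambda>x. ln x + 1)" using True by (auto simp: pot'_def)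
  then show ?thesis using True assms
    by (auto intro!: derivative_eq_intros simp: powr_minus field_simps)
next
  case False
  have "pot' s = (\<lambda>x. x powr (s - 1) / (s - 1))" using False by (auto simp: pot'_def)
  moreover have "((\<lambda>x. x powr (s - 1) / (s - 1)) has_real_derivative x powr (s - 1 - 1)) (at x)"
    using False assms by (auto intro!: derivative_eq_intros)
  ultimately show ?thesis by simp
qed

text \<open>The second derivative is controlled only between the two points, so a minorant valid on
  that interval alone may be subtracted from it.\<close>

lemma mid_gap_nonneg:
  assumes "0 < a" "0 < b"
    and "\<And>x. 0 < x \<Longrightarrow> (f has_real_derivative f' x) (at x)"
    and "\<And>x. 0 < x \<Longrightarrow> (f' has_real_derivative f'' x) (at x)"
    and "\<And>x. a \<le> x \<and> x \<le> b \<or> b \<le> x \<and> x \<le> a \<Longrightarrow> 0 \<le> f'' x"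
  shows "0 \<le> mid_gap f a b"
proof -
  define I where "I = {min a b..max a b}"
  have "convex_on I f"
  proof (rule f''_ge0_imp_convex)
    show "convex I" by (simp add: I_def)
    show "(f has_real_derivative f' x) (at x)" "(f' has_real_derivative f'' x) (at x)" "0 \<le> f'' x"
      if "x \<in> I" for x using that assms by (auto simp: I_def min_def max_def split: if_splits)
  qed
  then have "f ((1 - 1/2) *\<^sub>R a + (1/2) *\<^sub>R b) \<le> (1 - 1/2) * f a + (1/2) * f b"
    by (rule convex_onD) (auto simp: I_def)
  moreover have "(1 - 1/2) *\<^sub>R a + (1/2) *\<^sub>R b = (a + b) / 2" by (simp add: field_simps)
  ultimately have "f ((a + b) / 2) \<le> (1 - 1/2) * f a + (1/2) * f b" by (simp only:)
  then show ?thesis by (simp add: mid_gap_def)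
qed

text \<open>Strictness comes from subtracting \<open>\<delta> * x\<^sup>2 / 2\<close>, where
  \<open>\<delta>\<close> is the least value of the monotone second derivative: the rest stays
  convex, and the quadratic has gap \<open>\<delta> * (a - b)\<^sup>2 / 4\<close>.\<close>

lemma mid_gap_pot_pos:
  assumes "0 < a" "0 < b" "a \<noteq> b"
  shows "0 < mid_gap (pot s) a b"
proof -
  define \<delta> where "\<delta> = min (a powr (s - 2)) (b powr (s - 2))"
  have "\<delta> > 0" using assms by (auto simp: \<delta>_def)
  have ge: "\<delta> \<le> x powr (s - 2)" if "a \<le> x \<and> x \<le> b \<or> b \<le> x \<and> x \<le> a" for x
  proof (cases "s \<ge> 2")
    case True
    then show ?thesis
      using that assms powr_mono2[of "s - 2" a x] powr_mono2[of "s - 2" b x]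
      by (auto simp: \<delta>_def min_def)
  next
    case False
    then show ?thesis
      using that assms powr_mono2'[of "s - 2" x a] powr_mono2'[of "s - 2" x b]
      by (auto simp: \<delta>_def min_def)
  qed
  have "0 \<le> mid_gap (\<lambda>x. pot s x - \<delta> * x\<^sup>2 / 2) a b"
  proof (rule mid_gap_nonneg[OF assms(1,2)])
    show "((\<lambda>x. pot s x - \<delta> * x\<^sup>2 / 2) has_real_derivative (pot' s x - \<delta> * x)) (at x)"
      if "0 < x" for x
      by (auto intro!: derivative_eq_intros has_real_derivative_pot that)
    show "((\<lambda>x. pot' s x - \<delta> * x) has_real_derivative (x powr (s - 2) - \<delta>)) (at x)"
      if "0 < x" for x
      by (auto intro!: derivative_eq_intros has_real_derivative_pot' that)
  qed (use ge in auto)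
  also have "mid_gap (\<lambda>x. pot s x - \<delta> * x\<^sup>2 / 2) a b = mid_gap (pot s) a b - \<delta> * (a - b)\<^sup>2 / 4"
    by (simp add: mid_gap_def power2_eq_square field_simps)
  finally have "\<delta> * (a - b)\<^sup>2 / 4 \<le> mid_gap (pot s) a b" by simp
  moreover have "0 < \<delta> * (a - b)\<^sup>2 / 4" using \<open>\<delta> > 0\<close> assms by simp
  ultimately show ?thesis by linarith
qed

text \<open>In the generic case the normalising factors \<open>s * (s - 1)\<close> and
  \<open>(s + 1) * s\<close> leave exactly the prefactor \<open>(s - 1) / (s + 1)\<close>.\<close>

lemma lambda_mean_eq_quotient:
  assumes "0 < a" "0 < b" "a \<noteq> b"
  shows "lambda_mean s a b = mid_gap (pot (s + 1)) a b / mid_gap (pot s) a b"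
proof -
  consider "s = -1" | "s = 0" | "s = 1" | "s \<noteq> -1" "s \<noteq> 0" "s \<noteq> 1" by blast
  then show ?thesis
  proof cases
    case 1
    have "mid_gap (pot (-1)) a b = 1 / (2 * a) + 1 / (2 * b) - 2 / (a + b)"
      using assms by (simp add: mid_gap_def pot_def powr_minus divide_simps) (simp add: algebra_simps)
    moreover have "mid_gap (pot 0) a b = 2 * ln ((a + b) / 2) - ln a - ln b"
      by (simp add: mid_gap_def pot_def)
    ultimately show ?thesis using 1 assms by (simp add: lambda_mean_def)
  next
    case 2
    have "mid_gap (pot 1) a b = a * ln a + b * ln b - (a + b) * ln ((a + b) / 2)"
      by (simp add: mid_gap_def pot_def)
    moreover have "mid_gap (pot 0) a b = 2 * ln ((a + b) / 2) - ln a - ln b"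
      by (simp add: mid_gap_def pot_def)
    ultimately show ?thesis using 2 assms by (simp add: lambda_mean_def)
  next
    case 3
    have "mid_gap (pot 1) a b = a * ln a + b * ln b - (a + b) * ln ((a + b) / 2)"
      by (simp add: mid_gap_def pot_def)
    moreover have "mid_gap (pot 2) a b = (b - a)\<^sup>2 / 4"
      using assms by (simp add: mid_gap_def pot_def power2_eq_square field_simps)
    ultimately show ?thesis using 3 assms by (simp add: lambda_mean_def del: eq_divide_eq_numeral1)
  next
    case 4
    have "s + 1 \<noteq> 0" using 4 by auto
    have "mid_gap (pot s) a b
        = (a powr s + b powr s - 2 * ((a + b) / 2) powr s) / (s * (s - 1))"
      using 4 by (simp add: mid_gap_def pot_def add_divide_distrib diff_divide_distrib)
    moreover have "mid_gap (pot (s + 1)) a b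
        = (a powr (s + 1) + b powr (s + 1) - 2 * ((a + b) / 2) powr (s + 1)) / ((s + 1) * s)"
      using 4 \<open>s + 1 \<noteq> 0\<close> by (simp add: mid_gap_def pot_def add_divide_distrib diff_divide_distrib)
    ultimately show ?thesis using 4 assms \<open>s + 1 \<noteq> 0\<close> by (simp add: lambda_mean_def)
  qed
qed

text \<open>A midpoint gap integrates the second derivative against a tent kernel, so
  \<open>lambda_mean s a b\<close> is the average of \<open>x\<close> with weight kernel times
  \<open>x powr (s - 2)\<close>; raising \<open>s\<close> shifts weight to larger \<open>x\<close>.
  The convex potential \<open>h\<close> expresses this without integrals.\<close>

lemma lambda_mean_mono:
  assumes "0 < a" "0 < b" "s \<le> t"
  shows "lambda_mean s a b \<le> lambda_mean t a b"
proof (cases "a = b")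
  case True
  then show ?thesis by (simp add: lambda_mean_def)
next
  case False
  define c where "c = lambda_mean s a b"
  define C where "C = c powr (t - s)"
  note pos = mid_gap_pot_pos[OF assms(1,2) False]
  have c: "c = mid_gap (pot (s + 1)) a b / mid_gap (pot s) a b"
    unfolding c_def by (rule lambda_mean_eq_quotient[OF assms(1,2) False])
  then have "c > 0" using pos[of s] pos[of "s + 1"] by simp
  have eq: "mid_gap (pot (s + 1)) a b - c * mid_gap (pot s) a b = 0"
    using c pos[of s] by simp
  \<comment> \<open>\<open>h'' = (x - c) (x powr (t - s) - c powr (t - s)) x powr (s - 2) \<ge> 0\<close>, and \<open>c\<close> kills the last bracket.\<close>
  define h where "h = (\<lambda>x. pot (t + 1) x - c * pot t x - C * (pot (s + 1) x - c * pot s x))"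
  have "0 \<le> mid_gap h a b"
  proof (rule mid_gap_nonneg[OF assms(1,2)])
    show "(h has_real_derivative pot' (t + 1) x - c * pot' t x
        - C * (pot' (s + 1) x - c * pot' s x)) (at x)" if "0 < x" for x
      unfolding h_def by (auto intro!: derivative_eq_intros has_real_derivative_pot that)
    show "((\<lambda>x. pot' (t + 1) x - c * pot' t x - C * (pot' (s + 1) x - c * pot' s x))
        has_real_derivative x powr (t + 1 - 2) - c * x powr (t - 2)
        - C * (x powr (s + 1 - 2) - c * x powr (s - 2))) (at x)" if "0 < x" for x
      by (rule derivative_eq_intros has_real_derivative_pot' that | simp)+
    fix x assume "a \<le> x \<and> x \<le> b \<or> b \<le> x \<and> x \<le> a"
    then have "x > 0" using assms by auto
    have 1: "x powr (r + 1 - 2) = x * x powr (r - 2)" for r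
      using \<open>x > 0\<close> powr_add[of x 1 "r - 2"] by (simp add: add.commute)
    have 2: "x powr (t - 2) = x powr (t - s) * x powr (s - 2)"
      by (simp flip: powr_add)
    have "0 \<le> (x - c) * (x powr (t - s) - c powr (t - s))"
    proof (cases "x \<le> c")
      case True
      then show ?thesis using \<open>x > 0\<close> assms by (intro mult_nonpos_nonpos) (auto intro: powr_mono2)
    next
      case False
      then show ?thesis using \<open>c > 0\<close> assms by (intro mult_nonneg_nonneg) (auto intro: powr_mono2)
    qed
    then have "0 \<le> x powr (s - 2) * ((x - c) * (x powr (t - s) - C))"
      by (simp add: C_def)
    also have "\<dots> = x powr (t + 1 - 2) - c * x powr (t - 2)
        - C * (x powr (s + 1 - 2) - c * x powr (s - 2))"
      unfolding 1 2 by (simp add: algebra_simps)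
    finally show "0 \<le> \<dots>" .
  qed
  also have "mid_gap h a b = mid_gap (pot (t + 1)) a b - c * mid_gap (pot t) a b
      - C * (mid_gap (pot (s + 1)) a b - c * mid_gap (pot s) a b)"
    by (simp add: mid_gap_def h_def algebra_simps)
  finally have "c * mid_gap (pot t) a b \<le> mid_gap (pot (t + 1)) a b"
    using eq by simp
  then have "c \<le> mid_gap (pot (t + 1)) a b / mid_gap (pot t) a b"
    using pos[of t] by (simp add: field_simps)
  then show ?thesis
    unfolding c_def lambda_mean_eq_quotient[OF assms(1,2) False, of t] .
qed

section \<open>Homogeneity, symmetry and reduction to pairs \<open>(1 - t, 1 + t)\<close>\<close>

lemma lambda_mean_scale:
  assumes "0 < k" "0 < a" "0 < b" "s > 0"
  shows "lambda_mean s (k * a) (k * b) = k * lambda_mean s a b"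
proof -
  have m: "(k * a + k * b) / 2 = k * ((a + b) / 2)" by (simp add: algebra_simps)
  consider "a = b" | "a \<noteq> b" "s = 1" | "a \<noteq> b" "s \<noteq> 1" by blast
  then show ?thesis
  proof cases
    case 1
    then show ?thesis by (simp add: lambda_mean_def)
  next
    case 2
    \<comment> \<open>The terms in \<open>ln k\<close> cancel because their weights
      \<open>k * a\<close>, \<open>k * b\<close> and \<open>- (k * a + k * b)\<close> add up to
      zero.\<close>
    have "k * a * ln (k * a) + k * b * ln (k * b) - (k * a + k * b) * ln ((k * a + k * b) / 2)
       = k * (a * ln a + b * ln b - (a + b) * ln ((a + b) / 2))"
      using assms unfolding m by (subst (1 2 3) ln_mult_pos) (auto simp: algebra_simps)
    moreover have "(k * b - k * a)\<^sup>2 = k * (k * (b - a)\<^sup>2)"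
      by (simp add: power2_eq_square algebra_simps)
    ultimately show ?thesis using 2 assms by (simp add: lambda_mean_def)
  next
    case 3
    have "(k * a) powr r + (k * b) powr r - 2 * ((k * a + k * b) / 2) powr r
       = k powr r * (a powr r + b powr r - 2 * ((a + b) / 2) powr r)" for r
      using assms unfolding m by (subst (1 2 3) powr_mult) (auto simp: algebra_simps)
    moreover have "k powr (s + 1) = k * k powr s" using assms by (simp add: powr_add)
    ultimately show ?thesis using 3 assms by (simp add: lambda_mean_def)
  qed
qed

lemma lambda_mean_commute: "lambda_mean s a b = lambda_mean s b a"
  by (simp add: lambda_mean_def algebra_simps power2_commute)

lemma log_mean_scale:
  assumes "0 < k" "0 < a" "0 < b"
  shows "log_mean (k * a) (k * b) = k * log_mean a b"
  using assms by (auto simp: log_mean_def ln_mult_pos simp flip: right_diff_distrib)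

lemma log_mean_commute: "log_mean a b = log_mean b a"
proof -
  have "(b - a) / (ln b - ln a) = (a - b) / (ln a - ln b)"
    using minus_divide_divide[of "b - a" "ln b - ln a"] by simp
  then show ?thesis by (simp add: log_mean_def)
qed

lemma identric_mean_ln:
  assumes "0 < a" "0 < b" "a \<noteq> b"
  shows "identric_mean a b = exp ((b * ln b - a * ln a) / (b - a) - 1)"
proof -
  have "b powr b / a powr a = exp (b * ln b - a * ln a)"
    using assms by (simp add: powr_def exp_diff)
  then have "identric_mean a b = exp (-1) * exp (b * ln b - a * ln a) powr (1 / (b - a))"
    using assms by (simp add: identric_mean_def)
  also have "\<dots> = exp ((b * ln b - a * ln a) / (b - a) - 1)"
    by (simp add: powr_def flip: exp_add)
  finally show ?thesis .
qed

lemma identric_mean_commute: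
  assumes "0 < a" "0 < b"
  shows "identric_mean a b = identric_mean b a"
proof (cases "a = b")
  case False
  then have "(b * ln b - a * ln a) / (b - a) = (a * ln a - b * ln b) / (a - b)"
    by (simp add: field_simps)
  then show ?thesis using False assms by (simp add: identric_mean_ln)
qed auto

lemma identric_mean_scale:
  assumes "0 < k" "0 < a" "0 < b"
  shows "identric_mean (k * a) (k * b) = k * identric_mean a b"
proof (cases "a = b")
  case False
  have "(k * b * ln (k * b) - k * a * ln (k * a)) / (k * b - k * a)
      = k * ((b - a) * ln k + (b * ln b - a * ln a)) / (k * (b - a))"
    using assms by (simp add: ln_mult_pos algebra_simps)
  also have "\<dots> = ln k + (b * ln b - a * ln a) / (b - a)"
    using assms False by (simp add: add_divide_distrib)
  finally show ?thesis using False assms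
    by (simp add: identric_mean_ln exp_add exp_diff)
qed (auto simp: identric_mean_def)

text \<open>Take \<open>a < b\<close> by symmetry and divide by the arithmetic mean; then
  \<open>t = (b - a) / (a + b)\<close>. Keeping \<open>P\<close> abstract lets both bounds use
  this.\<close>

lemma means_reduce:
  fixes P :: "real \<Rightarrow> real \<Rightarrow> bool"
  assumes "0 < a" "0 < b" "a \<noteq> b"
    and "\<And>a b. P a b \<Longrightarrow> 0 < a \<Longrightarrow> 0 < b \<Longrightarrow> P b a"
    and "\<And>k a b. P a b \<Longrightarrow> 0 < k \<Longrightarrow> 0 < a \<Longrightarrow> 0 < b \<Longrightarrow> P (k * a) (k * b)"
    and "\<And>t. 0 < t \<Longrightarrow> t < 1 \<Longrightarrow> P (1 - t) (1 + t)"
  shows "P a b"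
proof -
  have less: "P a b" if "0 < a" "a < b" for a b
  proof -
    define t where "t = (b - a) / (a + b)"
    have t: "0 < t" "t < 1" using that by (auto simp: t_def)
    have eq: "(a + b) / 2 * (1 - t) = a" "(a + b) / 2 * (1 + t) = b"
      using that by (auto simp: t_def field_simps)
    have "P ((a + b) / 2 * (1 - t)) ((a + b) / 2 * (1 + t))"
      using that t by (intro assms(5) assms(6)) auto
    then show ?thesis unfolding eq .
  qed
  then show ?thesis using assms(1-4) less[of a b] less[of b a] by (metis linorder_neqE)
qed

section \<open>The identric mean\<close>

text \<open>A one-sided limit replaces the value at \<open>0\<close>, because several of the
  functions below take the form 0/0 there.\<close>

lemma nonneg_of_deriv_nonneg_right_limit:
  fixes f :: "real \<Rightarrow> real"
  assumes lim: "(f \<longlongrightarrow> 0) (at_right 0)"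
    and deriv: "\<And>x. 0 < x \<Longrightarrow> x \<le> t \<Longrightarrow> (f has_real_derivative f' x) (at x)"
    and nonneg: "\<And>x. 0 < x \<Longrightarrow> x \<le> t \<Longrightarrow> 0 \<le> f' x"
    and "0 < t"
  shows "0 \<le> f t"
proof (rule tendsto_upperbound[OF lim])
  have "f x \<le> f t" if "0 < x" "x < t" for x
  proof (rule DERIV_nonneg_imp_nondecreasing[of x t f])
    fix y assume "x \<le> y" "y \<le> t"
    then show "\<exists>z. (f has_real_derivative z) (at y) \<and> 0 \<le> z"
      using deriv[of y] nonneg[of y] that by auto
  qed (use that in auto)
  then show "\<forall>\<^sub>F x in at_right 0. f x \<le> f t"
    using eventually_at_right_real[OF \<open>0 < t\<close>] by (auto elim: eventually_mono)
qed auto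

text \<open>Three differentiations, each clearing one logarithm, reduce the claim to
  \<open>v \<le> (v ^ 3 + 2) / 3\<close> with \<open>v = (1 - t\<^sup>2) powr (1/3)\<close>.\<close>

lemma lambda_mean_one_le_identric_mean_unit:
  assumes "0 < t" "t < 1"
  shows "lambda_mean 1 (1 - t) (1 + t) \<le> identric_mean (1 - t) (1 + t)"
proof -
  \<comment> \<open>\<open>A x\<close> is \<open>2 * artanh x\<close> and \<open>D x\<close> is
    \<open>- ln (1 - x\<^sup>2)\<close>; all logarithms of \<open>1 - x\<close> and
    \<open>1 + x\<close> are expressed through these two.\<close>
  define A where "A = (\<lambda>x::real. ln (1 + x) - ln (1 - x))"
  define D where "D = (\<lambda>x::real. - ln (1 + x) - ln (1 - x))"
  have w: "0 < 1 - x\<^sup>2" if "0 < x" "x < 1" for x :: real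
    using that by (simp add: power_less_one_iff abs_square_less_1)
  have dA: "(A has_real_derivative 2 / (1 - x\<^sup>2)) (at x)" if "0 < x" "x < 1" for x
  proof -
    have "1 / (1 + x) + 1 / (1 - x) = 2 / (1 - x\<^sup>2)"
      using that w[OF that] by (simp add: field_simps power2_eq_square)
    then show ?thesis
      using that unfolding A_def by (auto intro!: derivative_eq_intros)
  qed
  have dD: "(D has_real_derivative 2 * x / (1 - x\<^sup>2)) (at x)" if "0 < x" "x < 1" for x
  proof -
    have "1 / (1 - x) - 1 / (1 + x) = 2 * x / (1 - x\<^sup>2)"
      using that w[OF that] by (simp add: field_simps power2_eq_square)
    then show ?thesis
      using that unfolding D_def by (auto intro!: derivative_eq_intros)
  qed
  have A_pos: "0 < A x" if "0 < x" "x < 1" for x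
    using that by (simp add: A_def)

  \<comment> \<open>The cube of this bound is what the derivative in \<open>D_ge\<close> requires.
    After taking the cube root \<open>A\<close> enters linearly, so one differentiation removes
    it.\<close>
  have A_le: "0 \<le> 2 * x * (1 - x\<^sup>2) powr (-1/3) - A x" if "0 < x" "x < 1" for x
  proof (rule nonneg_of_deriv_nonneg_right_limit
      [where f = "\<lambda>x. 2 * x * (1 - x\<^sup>2) powr (-1/3) - A x"
       and f' = "\<lambda>x. 2 * (1 - x\<^sup>2) powr (-1/3) + 4/3 * x\<^sup>2 * (1 - x\<^sup>2) powr (-4/3) - 2 / (1 - x\<^sup>2)"])
    show "((\<lambda>x. 2 * x * (1 - x\<^sup>2) powr (-1/3) - A x) \<longlongrightarrow> 0) (at_right 0)"
      unfolding A_def by real_asymp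
    fix y assume y: "0 < y" "y \<le> x"
    then have y1: "y < 1" using that by simp
    note wy = w[OF y(1) y1]
    show "((\<lambda>x. 2 * x * (1 - x\<^sup>2) powr (-1/3) - A x) has_real_derivative
       2 * (1 - y\<^sup>2) powr (-1/3) + 4/3 * y\<^sup>2 * (1 - y\<^sup>2) powr (-4/3) - 2 / (1 - y\<^sup>2)) (at y)"
      using wy by (auto intro!: derivative_eq_intros dA y y1 simp: power2_eq_square)
    define v where "v = (1 - y\<^sup>2) powr (1/3)"
    have v: "v > 0" using wy by (simp add: v_def)
    have v3: "v ^ 3 = 1 - y\<^sup>2"
      using wy by (simp add: v_def powr_power)
    have p1: "(1 - y\<^sup>2) powr (-1/3) = 1 / v"
      using powr_minus_divide[of "1 - y\<^sup>2" "1/3"] by (simp add: v_def)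
    have "v ^ 4 = (1 - y\<^sup>2) powr (4/3)"
      using wy by (simp add: v_def powr_power)
    then have p4: "(1 - y\<^sup>2) powr (-4/3) = 1 / v ^ 4"
      using powr_minus_divide[of "1 - y\<^sup>2" "4/3"] by simp
    have y2: "y\<^sup>2 = 1 - v ^ 3" using v3 by simp
    have "2 * (1 / v) + 4/3 * (1 - v ^ 3) * (1 / v ^ 4) - 2 / v ^ 3
       = 2/3 * ((v - 1)\<^sup>2 * (v + 2)) / v ^ 4"
      using v by (simp add: field_simps power2_eq_square eval_nat_numeral)
    also have "0 \<le> \<dots>" using v by simp
    finally show "0 \<le> 2 * (1 - y\<^sup>2) powr (-1/3) + 4/3 * y\<^sup>2 * (1 - y\<^sup>2) powr (-4/3) - 2 / (1 - y\<^sup>2)"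
      unfolding p1 p4 unfolding y2 by simp
  qed (use that in auto)

  have A_cube: "A x ^ 3 \<le> 8 * x ^ 3 / (1 - x\<^sup>2)" if "0 < x" "x < 1" for x
  proof -
    have "A x ^ 3 \<le> (2 * x * (1 - x\<^sup>2) powr (-1/3)) ^ 3"
      using A_le[OF that] A_pos[OF that] by (intro power_mono) auto
    also have "\<dots> = 8 * x ^ 3 * (1 - x\<^sup>2) powr (-1)"
      using w[OF that] by (simp add: power_mult_distrib powr_power)
    also have "\<dots> = 8 * x ^ 3 / (1 - x\<^sup>2)"
      using w[OF that] powr_minus_divide[of "1 - x\<^sup>2" 1] by simp
    finally show ?thesis .
  qed

  \<comment> \<open>The numerator of the derivative of \<open>F\<close> below is
    \<open>D x * (A x + 2 * x) - x * (A x)\<^sup>2\<close>. Dividing by the coefficient of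
    \<open>D\<close> lets differentiation eliminate \<open>D\<close>, and \<open>A_cube\<close>
    settles the sign of what remains.\<close>
  have D_ge: "0 \<le> D x - x * (A x)\<^sup>2 / (A x + 2 * x)" if "0 < x" "x < 1" for x
  proof (rule nonneg_of_deriv_nonneg_right_limit
      [where f = "\<lambda>x. D x - x * (A x)\<^sup>2 / (A x + 2 * x)"
       and f' = "\<lambda>x. (8 * x ^ 3 / (1 - x\<^sup>2) - A x ^ 3) / (A x + 2 * x)\<^sup>2"])
    show "((\<lambda>x. D x - x * (A x)\<^sup>2 / (A x + 2 * x)) \<longlongrightarrow> 0) (at_right 0)"
      unfolding A_def D_def by real_asymp
    fix y assume y: "0 < y" "y \<le> x"
    then have y1: "y < 1" using that by simp
    note wy = w[OF y(1) y1] and Ay = A_pos[OF y(1) y1]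
    have pos: "A y + 2 * y > 0" using Ay y by simp
    show "0 \<le> (8 * y ^ 3 / (1 - y\<^sup>2) - A y ^ 3) / (A y + 2 * y)\<^sup>2"
      using A_cube[OF y(1) y1] by simp
    define B where "B = 2 / (1 - y\<^sup>2)"
    have dB: "(A has_real_derivative B) (at y)" "(D has_real_derivative y * B) (at y)"
      using dA[OF y(1) y1] dD[OF y(1) y1] by (simp_all add: B_def mult.commute)
    have "((\<lambda>x. D x - x * (A x)\<^sup>2 / (A x + 2 * x)) has_real_derivative
       y * B - (((A y)\<^sup>2 + y * (2 * A y * B)) * (A y + 2 * y) - y * (A y)\<^sup>2 * (B + 2))
         / ((A y + 2 * y) * (A y + 2 * y))) (at y)"
      using pos by (auto intro!: derivative_eq_intros dB simp: algebra_simps)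
    also have "y * B - (((A y)\<^sup>2 + y * (2 * A y * B)) * (A y + 2 * y) - y * (A y)\<^sup>2 * (B + 2))
         / ((A y + 2 * y) * (A y + 2 * y)) = (4 * y ^ 3 * B - A y ^ 3) / (A y + 2 * y)\<^sup>2"
      using pos by (simp add: divide_simps) (simp add: algebra_simps power2_eq_square power3_eq_cube)
    also have "4 * y ^ 3 * B = 8 * y ^ 3 / (1 - y\<^sup>2)" by (simp add: B_def)
    finally show "((\<lambda>x. D x - x * (A x)\<^sup>2 / (A x + 2 * x)) has_real_derivative
      (8 * y ^ 3 / (1 - y\<^sup>2) - A y ^ 3) / (A y + 2 * y)\<^sup>2) (at y)" .
  qed (use that in auto)

  define g where "g = (\<lambda>x. x * A x - D x)"
  \<comment> \<open>\<open>F x\<close> is the logarithm of the identric mean of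
    \<open>(1 - x, 1 + x)\<close> minus that of \<open>lambda_mean 1\<close>, which equals
    \<open>x\<^sup>2 / g x\<close>.\<close>
  define F where "F = (\<lambda>x. (A x - x * D x) / (2 * x) - 1 + ln (g x) - 2 * ln x)"
  have g_eq: "g x = mid_gap (pot 1) (1 - x) (1 + x)" for x
    by (simp add: g_def A_def D_def mid_gap_def pot_def algebra_simps)
  have g_pos: "0 < g x" if "0 < x" "x < 1" for x
    unfolding g_eq using that by (intro mid_gap_pot_pos) auto
  have "0 \<le> F t"
  proof (rule nonneg_of_deriv_nonneg_right_limit
      [where f = F and t = t and f' = "\<lambda>x. (D x * (A x + 2 * x) - x * (A x)\<^sup>2) / (2 * x\<^sup>2 * g x)"])
    show "(F \<longlongrightarrow> 0) (at_right 0)"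
      unfolding F_def g_def A_def D_def by real_asymp
    fix y assume y: "0 < y" "y \<le> t"
    then have y1: "y < 1" using assms by simp
    note wy = w[OF y(1) y1] and Ay = A_pos[OF y(1) y1] and gy = g_pos[OF y(1) y1]
    have "x * (A x)\<^sup>2 \<le> D x * (A x + 2 * x)" if "0 < x" "x < 1" for x
      using D_ge[OF that] A_pos[OF that] that by (simp add: pos_divide_le_eq)
    from this[OF y(1) y1] show "0 \<le> (D y * (A y + 2 * y) - y * (A y)\<^sup>2) / (2 * y\<^sup>2 * g y)"
      using gy by simp
    define B where "B = 2 / (1 - y\<^sup>2)"
    have dB: "(A has_real_derivative B) (at y)" "(D has_real_derivative y * B) (at y)"
      using dA[OF y(1) y1] dD[OF y(1) y1] by (simp_all add: B_def mult.commute)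
    have dg: "(g has_real_derivative A y) (at y)"
      unfolding g_def by (auto intro!: derivative_eq_intros dB)
    \<comment> \<open>This turns the derivative \<open>B - D y - y * y * B\<close> of
      \<open>U\<close> into \<open>2 - D y\<close>.\<close>
    have yB: "y * y * B = B - 2" using wy by (simp add: B_def field_simps power2_eq_square)
    define U where "U = (\<lambda>x. A x - x * D x)"
    have dU: "(U has_real_derivative 2 - D y) (at y)"
      using yB unfolding U_def by (auto intro!: derivative_eq_intros dB simp: algebra_simps)
    have "F = (\<lambda>x. U x / (2 * x) - 1 + ln (g x) - 2 * ln x)"
      by (simp add: F_def U_def)
    then have "(F has_real_derivative
       ((2 - D y) * (2 * y) - U y * 2) / (2 * y * (2 * y)) + A y / g y - 2 / y) (at y)"
      using y gy by (auto intro!: derivative_eq_intros dg dU)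
    then have "(F has_real_derivative
       ((2 - D y) * (2 * y) - (A y - y * D y) * 2) / (2 * y * (2 * y)) + A y / g y - 2 / y) (at y)"
      by (simp only: U_def)
    also have "((2 - D y) * (2 * y) - (A y - y * D y) * 2) / (2 * y * (2 * y)) = (2 * y - A y) / (2 * y\<^sup>2)"
      using y by (simp add: divide_simps power2_eq_square) (simp add: algebra_simps)
    also have "(2 * y - A y) / (2 * y\<^sup>2) + A y / g y - 2 / y
       = ((2 * y - A y) * g y + 2 * y\<^sup>2 * A y - 4 * y * g y) / (2 * y\<^sup>2 * g y)"
      using y gy by (simp add: divide_simps power2_eq_square)
    also have "(2 * y - A y) * g y + 2 * y\<^sup>2 * A y - 4 * y * g y = D y * (A y + 2 * y) - y * (A y)\<^sup>2"
      by (simp add: g_def algebra_simps power2_eq_square)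
    finally show "(F has_real_derivative (D y * (A y + 2 * y) - y * (A y)\<^sup>2) / (2 * y\<^sup>2 * g y)) (at y)" .
  qed (use assms in auto)
  then have "ln (t\<^sup>2 / g t) \<le> (A t - t * D t) / (2 * t) - 1"
    using assms g_pos[OF assms] by (simp add: F_def ln_div ln_realpow)
  moreover have "g t = (1 - t) * ln (1 - t) + (1 + t) * ln (1 + t)"
    by (simp add: g_def A_def D_def algebra_simps)
  then have "lambda_mean 1 (1 - t) (1 + t) = t\<^sup>2 / g t"
    using assms by (simp add: lambda_mean_def power2_eq_square del: distrib_left_numeral)
  moreover have "identric_mean (1 - t) (1 + t) = exp ((A t - t * D t) / (2 * t) - 1)"
    using assms by (simp add: identric_mean_ln A_def D_def algebra_simps)
  ultimately show ?thesis
    using assms g_pos[OF assms] by (metis divide_pos_pos exp_le_cancel_iff exp_ln zero_less_power)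
qed

lemma lambda_mean_le_identric_mean:
  assumes "0 < a" "0 < b" "s \<le> 1"
  shows "lambda_mean s a b \<le> identric_mean a b"
proof (cases "a = b")
  case False
  have "lambda_mean 1 a b \<le> identric_mean a b"
  proof (rule means_reduce[OF assms(1,2) False])
    show "lambda_mean 1 b a \<le> identric_mean b a"
      if "lambda_mean 1 a b \<le> identric_mean a b" "0 < a" "0 < b" for a b
      using that lambda_mean_commute identric_mean_commute by metis
    show "lambda_mean 1 (k * a) (k * b) \<le> identric_mean (k * a) (k * b)"
      if "lambda_mean 1 a b \<le> identric_mean a b" "0 < k" "0 < a" "0 < b" for k a b
      using that by (simp add: lambda_mean_scale identric_mean_scale)
  qed (rule lambda_mean_one_le_identric_mean_unit)
  then show ?thesis using lambda_mean_mono[OF assms] by linarith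
qed (simp add: lambda_mean_def identric_mean_def)

section \<open>Failure of the upper bound beyond 1\<close>

text \<open>The difference of the two means, divided by \<open>t\<^sup>2\<close>, tends to
  \<open>(s - 2) / 6 + 1 / 6 = (s - 1) / 6 > 0\<close>. Larger \<open>s\<close> are covered later by
  monotonicity.\<close>

lemma ex_identric_mean_less:
  assumes "1 < s" "s < 2"
  shows "\<exists>a b. 0 < a \<and> 0 < b \<and> identric_mean a b < lambda_mean s a b"
proof -
  define p where "p = (\<lambda>t. ((1 - t) powr s + (1 + t) powr s - 2) / (s * (s - 1)))"
  define r where "r = (\<lambda>t. ((1 - t) powr (s + 1) + (1 + t) powr (s + 1) - 2) / ((s + 1) * s))"
  have p: "((\<lambda>t. p t / t^2) \<longlongrightarrow> 1) (at_right 0)"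
    using assms unfolding p_def by real_asymp (simp add: field_simps)
  \<comment> \<open>The expansion is taken before the division by the constant
    \<open>s * (s - 1)\<close>, which is carried out afterwards; likewise for
    \<open>r\<close>.\<close>
  have "((\<lambda>t. ((1 - t) powr s + (1 + t) powr s - 2 - s * (s - 1) * t^2) / t^4)
      \<longlongrightarrow> s * (s - 1) * (s - 2) * (s - 3) / 12) (at_right 0)"
    using assms by real_asymp
  then have "((\<lambda>t. ((1 - t) powr s + (1 + t) powr s - 2 - s * (s - 1) * t^2) / t^4 / (s * (s - 1)))
      \<longlongrightarrow> s * (s - 1) * (s - 2) * (s - 3) / 12 / (s * (s - 1))) (at_right 0)"
    using assms by (intro tendsto_divide[OF _ tendsto_const]) auto
  moreover have "((1 - t) powr s + (1 + t) powr s - 2 - s * (s - 1) * t^2) / t^4 / (s * (s - 1))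
      = (p t - t^2) / t^4" for t
    using assms by (simp add: p_def diff_divide_distrib add_divide_distrib mult_ac)
  moreover have "s * (s - 1) * (s - 2) * (s - 3) / 12 / (s * (s - 1)) = (s - 2) * (s - 3) / 12"
    using assms by (simp add: divide_simps) (simp add: algebra_simps)
  ultimately have p': "((\<lambda>t. (p t - t^2) / t^4) \<longlongrightarrow> (s - 2) * (s - 3) / 12) (at_right 0)"
    by (simp only:)
  have "((\<lambda>t. ((1 - t) powr (s + 1) + (1 + t) powr (s + 1) - 2 - (s + 1) * s * t^2) / t^4)
      \<longlongrightarrow> (s + 1) * s * (s - 1) * (s - 2) / 12) (at_right 0)"
    using assms by real_asymp
  then have "((\<lambda>t. ((1 - t) powr (s + 1) + (1 + t) powr (s + 1) - 2 - (s + 1) * s * t^2) / t^4 / ((s + 1) * s))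
      \<longlongrightarrow> (s + 1) * s * (s - 1) * (s - 2) / 12 / ((s + 1) * s)) (at_right 0)"
    using assms by (intro tendsto_divide[OF _ tendsto_const]) auto
  moreover have "((1 - t) powr (s + 1) + (1 + t) powr (s + 1) - 2 - (s + 1) * s * t^2) / t^4 / ((s + 1) * s)
      = (r t - t^2) / t^4" for t
    using assms by (simp add: r_def diff_divide_distrib add_divide_distrib mult_ac)
  moreover have "(s + 1) * s * (s - 1) * (s - 2) / 12 / ((s + 1) * s) = (s - 1) * (s - 2) / 12"
    using assms by (simp add: divide_simps)
  ultimately have r': "((\<lambda>t. (r t - t^2) / t^4) \<longlongrightarrow> (s - 1) * (s - 2) / 12) (at_right 0)"
    by (simp only:)
  \<comment> \<open>This quotient equals \<open>(r t / p t - 1) / t\<^sup>2\<close>, the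
    second-order term of \<open>lambda_mean\<close>, arranged so that each part has a known
    limit.\<close>
  have "((\<lambda>t. ((r t - t^2) / t^4 - (p t - t^2) / t^4) / (p t / t^2))
      \<longlongrightarrow> ((s - 1) * (s - 2) / 12 - (s - 2) * (s - 3) / 12) / 1) (at_right 0)"
    by (intro tendsto_intros p p' r') auto
  moreover have "((\<lambda>t::real. (exp (((1 + t) * ln (1 + t) - (1 - t) * ln (1 - t)) / (2 * t) - 1) - 1) / t\<^sup>2)
      \<longlongrightarrow> - 1 / 6) (at_right 0)"
    by real_asymp
  ultimately have "((\<lambda>t. ((r t - t^2) / t^4 - (p t - t^2) / t^4) / (p t / t^2)
      - (exp (((1 + t) * ln (1 + t) - (1 - t) * ln (1 - t)) / (2 * t) - 1) - 1) / t\<^sup>2)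
      \<longlongrightarrow> ((s - 1) * (s - 2) / 12 - (s - 2) * (s - 3) / 12) / 1 - (- 1 / 6)) (at_right 0)"
    by (rule tendsto_diff)
  moreover have "((s - 1) * (s - 2) / 12 - (s - 2) * (s - 3) / 12) / 1 - (- 1 / 6) > 0"
    using assms by (simp add: field_simps)
  ultimately have "\<forall>\<^sub>F t in at_right 0. 0 < ((r t - t^2) / t^4 - (p t - t^2) / t^4) / (p t / t^2)
      - (exp (((1 + t) * ln (1 + t) - (1 - t) * ln (1 - t)) / (2 * t) - 1) - 1) / t\<^sup>2"
    by (rule order_tendstoD)
  moreover have "\<forall>\<^sub>F t::real in at_right 0. t \<in> {0<..<1}"
    by (rule eventually_at_right_real) simp
  ultimately have "\<forall>\<^sub>F t in at_right 0. 0 < ((r t - t^2) / t^4 - (p t - t^2) / t^4) / (p t / t^2)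
      - (exp (((1 + t) * ln (1 + t) - (1 - t) * ln (1 - t)) / (2 * t) - 1) - 1) / t\<^sup>2
      \<and> t \<in> {0<..<1}"
    by (rule eventually_conj)
  from eventually_happens'[OF trivial_limit_at_right_real this]
  obtain t where t: "0 < t" "t < 1" and
    less: "(exp (((1 + t) * ln (1 + t) - (1 - t) * ln (1 - t)) / (2 * t) - 1) - 1) / t\<^sup>2
      < ((r t - t^2) / t^4 - (p t - t^2) / t^4) / (p t / t^2)"
    unfolding diff_gt_0_iff_gt greaterThanLessThan_iff by blast
  have "p t = mid_gap (pot s) (1 - t) (1 + t)"
    using assms by (simp add: p_def mid_gap_def pot_def diff_divide_distrib add_divide_distrib)
  moreover have "r t = mid_gap (pot (s + 1)) (1 - t) (1 + t)"
    using assms by (simp add: r_def mid_gap_def pot_def diff_divide_distrib add_divide_distrib)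
  ultimately have "lambda_mean s (1 - t) (1 + t) = r t / p t" and "0 < p t"
    using t mid_gap_pot_pos[of "1 - t" "1 + t" s] by (auto simp: lambda_mean_eq_quotient)
  moreover have "((r t - t^2) / t^4 - (p t - t^2) / t^4) / (p t / t^2) = (r t / p t - 1) / t\<^sup>2"
  proof -
    have cancel: "x / (u * u) / (y / u) = x / y / u" for x y u :: real
      by (cases "u = 0") auto
    have t4: "t ^ 4 = t\<^sup>2 * t\<^sup>2" by (simp flip: power_add)
    have "((r t - t^2) / t^4 - (p t - t^2) / t^4) / (p t / t^2) = (r t - p t) / t^4 / (p t / t^2)"
      by (simp flip: diff_divide_distrib)
    also have "\<dots> = (r t - p t) / p t / t\<^sup>2"
      unfolding t4 by (rule cancel)
    also have "(r t - p t) / p t = r t / p t - 1"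
      using \<open>0 < p t\<close> by (simp add: diff_divide_distrib)
    finally show ?thesis .
  qed
  moreover have "identric_mean (1 - t) (1 + t)
      = exp (((1 + t) * ln (1 + t) - (1 - t) * ln (1 - t)) / (2 * t) - 1)"
    using t by (simp add: identric_mean_ln)
  ultimately have "identric_mean (1 - t) (1 + t) < lambda_mean s (1 - t) (1 + t)"
    using less t by (simp add: divide_less_cancel)
  then show ?thesis using t by (intro exI[of _ "1 - t"] exI[of _ "1 + t"]) auto
qed

section \<open>The logarithmic mean\<close>

text \<open>\<open>bin_coeff s k\<close> is the coefficient of \<open>t ^ (2 * k + 2)\<close> in \<open>((1 + t) powr (s + 1)) / (s * (s + 1))\<close>.\<close>

primrec bin_coeff :: "real \<Rightarrow> nat \<Rightarrow> real" where
  "bin_coeff s 0 = 1 / 2"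
| "bin_coeff s (Suc k) =
    bin_coeff s k * ((2 * real k + 1 - s) * (2 * real k + 2 - s) / ((2 * real k + 3) * (2 * real k + 4)))"

lemma bin_coeff_pos: "s < 1 \<Longrightarrow> 0 < bin_coeff s k"
  by (induction k) (auto intro!: mult_pos_pos divide_pos_pos)

lemma gbinomial_Suc_real: "(s gchoose Suc n) = (s gchoose n) * (s - n) / (n + 1)" for s :: real
  by (simp add: gbinomial_prod_rev prod.atLeast0_lessThan_Suc mult.commute)

text \<open>The two binomial coefficients have ratio \<open>(s - 2 * k - 1) / (s + 1)\<close>, so
  one sequence, positive for \<open>s < 1\<close>, serves both numerator and denominator of
  \<open>lambda_mean\<close>.\<close>

lemma gbinomial_even_eq_bin_coeff:
  "(s gchoose (2 * k + 2)) = - s * bin_coeff s k * (2 * real k + 1 - s)"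
  "(s + 1 gchoose (2 * k + 2)) = (s + 1) * s * bin_coeff s k"
proof (induction k)
  case 0
  show "(s gchoose (2 * 0 + 2)) = - s * bin_coeff s 0 * (2 * real 0 + 1 - s)"
    "(s + 1 gchoose (2 * 0 + 2)) = (s + 1) * s * bin_coeff s 0"
    by (simp_all add: numeral_2_eq_2 gbinomial_Suc_real field_simps)
next
  case (Suc k)
  have e: "2 * Suc k + 2 = Suc (Suc (2 * k + 2))" by simp
  show "(s gchoose (2 * Suc k + 2)) = - s * bin_coeff s (Suc k) * (2 * real (Suc k) + 1 - s)"
    unfolding e gbinomial_Suc_real Suc.IH
    by (simp add: divide_simps) (simp add: algebra_simps)
  show "(s + 1 gchoose (2 * Suc k + 2)) = (s + 1) * s * bin_coeff s (Suc k)"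
    unfolding e gbinomial_Suc_real Suc.IH
    by (simp add: divide_simps) (simp add: algebra_simps)
qed

text \<open>Odd powers cancel in the sum of the two binomial series, and the constant term 2 is
  moved to the right.\<close>

lemma powr_sum_sums:
  fixes s t :: real
  assumes "\<bar>t\<bar> < 1"
  shows "(\<lambda>k. 2 * (s gchoose (2 * k + 2)) * t ^ (2 * k + 2)) sums ((1 - t) powr s + (1 + t) powr s - 2)"
proof -
  define f where "f = (\<lambda>n. (s gchoose n) * t ^ n + (s gchoose n) * (- t) ^ n)"
  have "f sums ((1 + t) powr s + (1 + (- t)) powr s)"
    unfolding f_def using assms by (intro sums_add gen_binomial_real) auto
  also have "f sums ((1 + t) powr s + (1 + (- t)) powr s)
      \<longleftrightarrow> (\<lambda>k. f (2 * k)) sums ((1 + t) powr s + (1 + (- t)) powr s)"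
  proof (rule sums_mono_reindex[symmetric])
    show "strict_mono (\<lambda>k::nat. 2 * k)" by (simp add: strict_mono_def)
    show "f n = 0" if "n \<notin> range (\<lambda>k::nat. 2 * k)" for n
    proof -
      have "odd n" using that by (auto elim: evenE)
      then show ?thesis by (simp add: f_def)
    qed
  qed
  finally have "(\<lambda>k. f (2 * Suc k)) sums ((1 + t) powr s + (1 + (- t)) powr s - f 0)"
    using sums_Suc_iff[of "\<lambda>k. f (2 * k)"] by simp
  moreover have "f (2 * Suc k) = 2 * (s gchoose (2 * k + 2)) * t ^ (2 * k + 2)" for k
    by (simp add: f_def)
  ultimately show ?thesis by (simp add: f_def add.commute mult_ac)
qed

text \<open>With \<open>u = t\<^sup>2\<close>, the inequality \<open>log_mean (1 - t) (1 + t) \<le> lambda_mean s (1 - t) (1 + t)\<close> amounts to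
  \<open>0 \<le> (\<Sum>n. lower_coeff s n * u ^ n)\<close>.\<close>

definition lower_coeff :: "real \<Rightarrow> nat \<Rightarrow> real" where
  "lower_coeff s n = (1 - s) * (\<Sum>k\<le>n. bin_coeff s k / real (2 * (n - k) + 1))
    - bin_coeff s n * (2 * real n + 1 - s)"

section \<open>From nonnegative partial sums to the lower bound\<close>

text \<open>Since \<open>u ^ n\<close> decreases, replacing each weight in a partial sum by the last
  one can only lower it. Single coefficients may have either sign.\<close>

lemma Abel_sum_nonneg:
  fixes h :: "nat \<Rightarrow> real"
  assumes "\<And>n. 0 \<le> (\<Sum>k\<le>n. h k)" "0 \<le> u" "u \<le> 1" "summable (\<lambda>k. h k * u ^ k)"
  shows "0 \<le> (\<Sum>k. h k * u ^ k)"
proof -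
  have ge: "(\<Sum>k\<le>n. h k) * u ^ n \<le> (\<Sum>k\<le>n. h k * u ^ k)" for n
  proof (induction n)
    case (Suc n)
    have "u ^ Suc n \<le> u ^ n" using assms by (intro power_decreasing) auto
    then have "(\<Sum>k\<le>n. h k) * u ^ Suc n \<le> (\<Sum>k\<le>n. h k) * u ^ n"
      using assms(1) by (rule mult_left_mono)
    then show ?case using Suc.IH by (simp add: distrib_right)
  qed simp
  have "0 \<le> (\<Sum>k\<le>n. h k) * u ^ n" for n using assms by simp
  then have "0 \<le> (\<Sum>k\<le>n. h k * u ^ k)" for n using ge order_trans by blast
  moreover have "(\<lambda>n. \<Sum>k\<le>n. h k * u ^ k) \<longlonglongrightarrow> (\<Sum>k. h k * u ^ k)"
    using assms(4) by (rule summable_LIMSEQ')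
  ultimately show ?thesis by (intro LIMSEQ_le_const) auto
qed

text \<open>Here \<open>lambda_mean\<close> is \<open>(1 - s) * X / Y\<close> and
  \<open>log_mean\<close> is \<open>1 / Z\<close>, so the claim is
  \<open>Y \<le> (1 - s) * X * Z\<close>; the Cauchy product of \<open>X\<close> and
  \<open>Z\<close> yields \<open>lower_coeff\<close>.\<close>

lemma log_mean_le_lambda_mean_unit:
  assumes s: "0 < s" "s < 1" and t: "0 < t" "t < 1"
    and partial: "\<And>n. 0 \<le> (\<Sum>k\<le>n. lower_coeff s k)"
  shows "log_mean (1 - t) (1 + t) \<le> lambda_mean s (1 - t) (1 + t)"
proof -
  define u where "u = t\<^sup>2"
  have u: "0 < u" "u < 1" using t by (auto simp: u_def power_less_one_iff abs_square_less_1)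
  have tu: "t ^ (2 * k + 2) = u * u ^ k" for k
    by (simp add: u_def power_mult power_add power2_eq_square)
  define P where "P = (\<lambda>r. (1 - t) powr r + (1 + t) powr r - 2)"
  define X where "X = (\<Sum>k. bin_coeff s k * u ^ k)"
  define Y where "Y = (\<Sum>k. bin_coeff s k * (2 * real k + 1 - s) * u ^ k)"
  define Z where "Z = (ln (1 + t) - ln (1 - t)) / (2 * t)"
  have Ps: "(\<lambda>k. 2 * (r gchoose (2 * k + 2)) * (u * u ^ k)) sums P r" for r
    unfolding P_def tu[symmetric] using t by (intro powr_sum_sums) auto
  have "(\<lambda>k. (2 * (s + 1) * s * u) * (bin_coeff s k * u ^ k)) sums P (s + 1)"
    using Ps[of "s + 1"] unfolding gbinomial_even_eq_bin_coeff(2) by (simp only: mult_ac)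
  from sums_mult_D[OF this] s u
  have X_sums: "(\<lambda>k. bin_coeff s k * u ^ k) sums (P (s + 1) / (2 * (s + 1) * s * u))" by simp
  have "2 * (- s * c * d) * (u * v) = (- 2 * s * u) * (c * d * v)" for c d v
    by (simp add: algebra_simps)
  then have "(\<lambda>k. (- 2 * s * u) * (bin_coeff s k * (2 * real k + 1 - s) * u ^ k)) sums P s"
    using Ps[of s] unfolding gbinomial_even_eq_bin_coeff(1) by (simp only:)
  from sums_mult_D[OF this] s u
  have Y_sums: "(\<lambda>k. bin_coeff s k * (2 * real k + 1 - s) * u ^ k) sums (P s / (- 2 * s * u))" by simp
  note X_eq = sums_unique[OF X_sums, folded X_def] and Y_eq = sums_unique[OF Y_sums, folded Y_def]
  have Y_pos: "0 < Y"
    unfolding Y_def using s u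
    by (intro suminf_pos sums_summable[OF Y_sums] mult_pos_pos bin_coeff_pos) auto
  have lam: "lambda_mean s (1 - t) (1 + t) = (1 - s) * X / Y"
  proof -
    have "lambda_mean s (1 - t) (1 + t) = (s - 1) / (s + 1) * (P (s + 1) / P s)"
      using s t by (simp add: lambda_mean_def P_def)
    also have "P (s + 1) = 2 * (s + 1) * s * u * X"
    proof -
      have "2 * (s + 1) * s * u \<noteq> 0" using s u by auto
      then show ?thesis using X_eq by (metis nonzero_eq_divide_eq mult.commute)
    qed
    also have "P s = - 2 * s * u * Y"
    proof -
      have "- 2 * s * u \<noteq> 0" using s u by auto
      then show ?thesis using Y_eq by (metis nonzero_eq_divide_eq mult.commute)
    qed
    also have "(s - 1) / (s + 1) * (2 * (s + 1) * s * u * X / (- 2 * s * u * Y)) = (1 - s) * X / Y"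
    proof -
      have "2 * (s + 1) * s * u * X / (- 2 * s * u * Y) = (2 * s * u) * ((s + 1) * X) / ((2 * s * u) * (- Y))"
        by (simp add: mult_ac)
      also have "\<dots> = (s + 1) * X / (- Y)" using s u by (intro mult_divide_mult_cancel_left) auto
      finally have "(s - 1) / (s + 1) * (2 * (s + 1) * s * u * X / (- 2 * s * u * Y))
          = (s - 1) * X / (- Y)" using s by simp
      then show ?thesis by (simp add: minus_divide_left[symmetric] left_diff_distrib diff_divide_distrib)
    qed
    finally show ?thesis .
  qed
  have Z_sums: "(\<lambda>k. u ^ k / real (2 * k + 1)) sums Z"
  proof -
    have "(1 + t) / (1 - t) > 0" using t by simp
    from ln_series_quadratic[OF this]
    have "(\<lambda>k. 2 * (((1 + t) / (1 - t) - 1) / ((1 + t) / (1 - t) + 1)) ^ (2 * k + 1) / real (2 * k + 1))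
        sums (ln (1 + t) - ln (1 - t))"
      using t by (simp add: ln_div)
    also have "((1 + t) / (1 - t) - 1) / ((1 + t) / (1 - t) + 1) = t"
      using t by (simp add: field_simps)
    also have "(\<lambda>k. 2 * t ^ (2 * k + 1) / real (2 * k + 1)) = (\<lambda>k. (2 * t) * (u ^ k / real (2 * k + 1)))"
      by (simp add: u_def power_mult mult.assoc)
    finally show ?thesis unfolding Z_def using t by (intro sums_mult_D) auto
  qed
  have Z_pos: "0 < Z" using t by (simp add: Z_def)
  have "(\<lambda>n. \<Sum>k\<le>n. bin_coeff s k * u ^ k * (u ^ (n - k) / real (2 * (n - k) + 1))) sums (X * Z)"
    unfolding X_def sums_unique[OF Z_sums]
  proof (rule Cauchy_product_sums)
    show "summable (\<lambda>k. norm (bin_coeff s k * u ^ k))"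
      using sums_summable[OF X_sums] s u bin_coeff_pos[of s] by (simp add: less_imp_le)
    show "summable (\<lambda>k. norm (u ^ k / real (2 * k + 1)))"
      using sums_summable[OF Z_sums] u by simp
  qed
  also have "(\<lambda>n. \<Sum>k\<le>n. bin_coeff s k * u ^ k * (u ^ (n - k) / real (2 * (n - k) + 1)))
      = (\<lambda>n. (\<Sum>k\<le>n. bin_coeff s k / real (2 * (n - k) + 1)) * u ^ n)"
  proof
    fix n
    have "bin_coeff s k * u ^ k * (u ^ (n - k) / real (2 * (n - k) + 1))
        = bin_coeff s k / real (2 * (n - k) + 1) * u ^ n" if "k \<le> n" for k
    proof -
      have "u ^ k * u ^ (n - k) = u ^ n" using that by (simp flip: power_add)
      then show ?thesis by (simp add: mult_ac)
    qed
    then show "(\<Sum>k\<le>n. bin_coeff s k * u ^ k * (u ^ (n - k) / real (2 * (n - k) + 1)))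
      = (\<Sum>k\<le>n. bin_coeff s k / real (2 * (n - k) + 1)) * u ^ n"
      unfolding sum_distrib_right by (intro sum.cong) auto
  qed
  finally have "(\<lambda>n. (1 - s) * ((\<Sum>k\<le>n. bin_coeff s k / real (2 * (n - k) + 1)) * u ^ n)
      - bin_coeff s n * (2 * real n + 1 - s) * u ^ n) sums ((1 - s) * (X * Z) - Y)"
    unfolding Y_def by (intro sums_diff sums_mult summable_sums sums_summable[OF Y_sums])
  moreover have "((1 - s) * p - q) * v = (1 - s) * (p * v) - q * v" for p q v :: real
    by (simp add: algebra_simps)
  ultimately have H_sums: "(\<lambda>n. lower_coeff s n * u ^ n) sums ((1 - s) * (X * Z) - Y)"
    by (simp only: lower_coeff_def)
  then have "0 \<le> (1 - s) * (X * Z) - Y"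
    using Abel_sum_nonneg[OF partial, of u] u by (simp add: sums_iff)
  then have "1 / Z \<le> (1 - s) * X / Y"
    using Y_pos Z_pos by (simp add: field_simps)
  moreover have "log_mean (1 - t) (1 + t) = 1 / Z"
    using t by (simp add: log_mean_def Z_def)
  ultimately show ?thesis using lam by simp
qed

text \<open>Fixed-point arithmetic at scale \<open>10 ^ 9\<close> for \<open>s = 909/10000\<close>, so that \<open>9091 = 10000 * (1 - s)\<close>.
  Division on \<open>int\<close> rounds down, hence \<open>bin_coeff_approx\<close> underestimates, by at most the index of the entry.
  In \<open>partial_sums_check\<close>, \<open>R\<close> lists the partial sums of \<open>1 / (2 * i + 1)\<close> in reverse order,
  and \<open>E\<close> accumulates an upper bound of the negative part of the partial sums of \<open>lower_coeff s\<close>.\<close>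

fun int_dot :: "int list \<Rightarrow> int list \<Rightarrow> int" where
  "int_dot (x # xs) (y # ys) = x * y + int_dot xs ys"
| "int_dot xs ys = 0"

fun bin_coeff_approx :: "nat \<Rightarrow> int \<Rightarrow> int \<Rightarrow> int list" where
  "bin_coeff_approx 0 k c = []"
| "bin_coeff_approx (Suc m) k c = c # bin_coeff_approx m (k + 1)
     (c * ((20000 * k + 9091) * (20000 * k + 19091)) div ((2 * k + 3) * (2 * k + 4) * 100000000))"

fun partial_sums_check :: "int list \<Rightarrow> int list \<Rightarrow> int list \<Rightarrow> int \<Rightarrow> int \<Rightarrow> bool" where
  "partial_sums_check C [] R k E = True"
| "partial_sums_check C (c # cs) R k E =
    (let R' = (hd R + 1000000000 div (2 * k + 1)) # R;
         E' = E + (c + k) * (20000 * k + 9091) in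
     1000000000 * E' \<le> 9091 * int_dot C R' \<and> partial_sums_check C cs R' (k + 1) E')"

text \<open>The run starts at index 1 with index 0 already entered in \<open>R\<close> and
  \<open>E\<close>, because \<open>hd R\<close> needs a nonempty list.\<close>

lemma partial_sums_check_76: "partial_sums_check (bin_coeff_approx 76 0 500000000) (tl (bin_coeff_approx 76 0 500000000)) [1000000000] 1 (500000000 * 9091)"
proof -
  have "let C = bin_coeff_approx 76 0 500000000 in partial_sums_check C (tl C) [1000000000] 1 (500000000 * 9091)" by code_simp
  then show ?thesis by (simp only: Let_def)
qed

text \<open>This is the base case \<open>n = 75\<close> of the tail estimate:
  \<open>1500000 + 9091\<close> is \<open>10000 * (2 * 75 + 1 - s)\<close>, \<open>151\<close> is
  \<open>2 * 75 + 1\<close>, and the added \<open>75\<close> covers the rounding error of the last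
  entry.\<close>

lemma sum_bin_coeff_approx_ge:
  "(let C = bin_coeff_approx 76 0 500000000 in (last C + 75) * (1500000 + 9091) * 151 \<le> 9091 * sum_list C)"
  by code_simp

section \<open>Soundness of the fixed-point arithmetic\<close>

definition odd_harm_approx :: "nat \<Rightarrow> int" where
  "odd_harm_approx n = (\<Sum>i\<le>n. 1000000000 div (2 * int i + 1))"

lemma length_bin_coeff_approx: "length (bin_coeff_approx m k c) = m"
  by (induction m k c rule: bin_coeff_approx.induct) auto

lemma int_dot_eq_sum: "int_dot xs ys = (\<Sum>i<min (length xs) (length ys). xs ! i * ys ! i)"
proof (induction xs ys rule: int_dot.induct)
  case (1 x xs y ys)
  then show ?case by (simp add: sum.lessThan_Suc_shift del: sum.lessThan_Suc)
qed auto

text \<open>Storing one factor in reverse makes a convolution a dot product; \<open>int_dot\<close>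
  ignores the surplus entries of \<open>C\<close>.\<close>

lemma int_dot_rev_eq_sum:
  assumes "n < length C"
  shows "int_dot C (rev (map f [0..<Suc n])) = (\<Sum>i\<le>n. C ! i * f (n - i))"
proof -
  have "int_dot C (rev (map f [0..<Suc n])) = (\<Sum>i<Suc n. C ! i * rev (map f [0..<Suc n]) ! i)"
    using assms unfolding int_dot_eq_sum by (intro sum.cong) (auto simp del: upt_Suc)
  also have "\<dots> = (\<Sum>i<Suc n. C ! i * f (n - i))"
    by (intro sum.cong refl) (simp add: rev_nth del: upt_Suc)
  finally show ?thesis by (simp only: lessThan_Suc_atMost)
qed

text \<open>The assumptions on \<open>cs\<close>, \<open>R\<close> and \<open>E\<close> are the loop
  invariant at index \<open>k\<close>; each call of the check settles the case \<open>n = k\<close>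
  and passes the invariant on to \<open>Suc k\<close>.\<close>

lemma partial_sums_check_sound:
  assumes "partial_sums_check C cs R (int k) E" "drop k C = cs" "0 < k"
    "R = rev (map odd_harm_approx [0..<k])"
    "E = (\<Sum>i<k. (C ! i + int i) * (20000 * int i + 9091))" "k \<le> n" "n < length C"
  shows "1000000000 * (\<Sum>i\<le>n. (C ! i + int i) * (20000 * int i + 9091))
     \<le> 9091 * (\<Sum>i\<le>n. C ! i * odd_harm_approx (n - i))"
  using assms
proof (induction cs arbitrary: R k E)
  case Nil
  then show ?case by simp
next
  case (Cons c cs)
  define R' where "R' = (hd R + 1000000000 div (2 * int k + 1)) # R"
  define E' where "E' = E + (c + int k) * (20000 * int k + 9091)"
  have chk: "1000000000 * E' \<le> 9091 * int_dot C R'" "partial_sums_check C cs R' (int (Suc k)) E'"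
    using Cons.prems(1) by (simp_all add: Let_def R'_def E'_def add.commute)
  have k: "k < length C" using Cons.prems by simp
  have c: "c = C ! k" and cs: "drop (Suc k) C = cs"
    using Cons.prems(2) Cons_nth_drop_Suc[OF k] by auto
  obtain k' where k': "k = Suc k'" using Cons.prems(3) by (cases k) auto
  have "hd R = odd_harm_approx k'" using Cons.prems(4) k' by simp
  then have R': "R' = rev (map odd_harm_approx [0..<Suc k])"
    using Cons.prems(4) k' by (simp add: R'_def odd_harm_approx_def)
  have E': "E' = (\<Sum>i<Suc k. (C ! i + int i) * (20000 * int i + 9091))"
    using Cons.prems(5) by (simp add: E'_def c)
  show ?case
  proof (cases "n = k")
    case True
    then show ?thesis
      using chk(1) k unfolding R' E' by (simp only: int_dot_rev_eq_sum lessThan_Suc_atMost)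
  next
    case False
    then show ?thesis
      using Cons.IH[OF chk(2) cs _ R' E'] Cons.prems(6,7) by simp
  qed
qed

text \<open>This is 1/11 truncated to four decimals.\<close>

abbreviation s1 :: real where "s1 \<equiv> 909 / 10000"

text \<open>The ratio of consecutive coefficients is at most 1, so inherited error does not grow,
  and each rounding adds at most one unit.\<close>

lemma bin_coeff_approx_bounds:
  assumes "c \<le> 1000000000 * bin_coeff s1 k" "1000000000 * bin_coeff s1 k \<le> c + real k" "i < m"
  shows "bin_coeff_approx m (int k) c ! i \<le> 1000000000 * bin_coeff s1 (k + i) \<and>
     1000000000 * bin_coeff s1 (k + i) \<le> bin_coeff_approx m (int k) c ! i + real (k + i)"
  using assms
proof (induction m arbitrary: k c i)
  case (Suc m)
  define a b where "a = (20000 * int k + 9091) * (20000 * int k + 19091)"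
    and "b = (2 * int k + 3) * (2 * int k + 4) * 100000000"
  have "a \<ge> 0" "b > 0" by (auto simp: a_def b_def)
  have "a \<le> b" by (auto simp: a_def b_def algebra_simps)
  have rec: "bin_coeff s1 (Suc k) = bin_coeff s1 k * (a / b)"
    by (simp add: a_def b_def divide_simps) (simp add: algebra_simps)
  define c' where "c' = c * a div b"
  have r: "0 \<le> real_of_int a / b" "real_of_int a / b \<le> 1"
    using \<open>a \<ge> 0\<close> \<open>b > 0\<close> \<open>a \<le> b\<close> by auto
  have fl: "c' \<le> real_of_int c * (a / b)" "real_of_int c * (a / b) \<le> c' + 1"
    using floor_divide_of_int_eq[of "c * a" b, where ?'a = real] unfolding c'_def
    by (simp_all, linarith+)
  have "c' \<le> 1000000000 * bin_coeff s1 (Suc k)"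
    using fl(1) mult_right_mono[OF Suc.prems(1) r(1)] by (simp add: rec del: bin_coeff.simps)
  moreover have "1000000000 * bin_coeff s1 (Suc k) \<le> c' + real (Suc k)"
  proof -
    have "1000000000 * bin_coeff s1 (Suc k) \<le> (c + real k) * (a / b)"
      using mult_right_mono[OF Suc.prems(2) r(1)] by (simp add: rec del: bin_coeff.simps)
    also have "\<dots> \<le> c' + 1 + real k * 1"
      using fl(2) mult_left_mono[OF r(2), of "real k"] by (simp add: distrib_right add_divide_distrib)
    finally show ?thesis by simp
  qed
  ultimately have IH: "bin_coeff_approx m (int (Suc k)) c' ! j \<le> 1000000000 * bin_coeff s1 (Suc k + j) \<and>
     1000000000 * bin_coeff s1 (Suc k + j) \<le> bin_coeff_approx m (int (Suc k)) c' ! j + real (Suc k + j)"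
    if "j < m" for j using Suc.IH that by blast
  have eq: "bin_coeff_approx (Suc m) (int k) c = c # bin_coeff_approx m (int (Suc k)) c'"
    by (simp add: c'_def a_def b_def add.commute)
  show ?case
  proof (cases i)
    case 0
    then show ?thesis using Suc.prems eq by simp
  next
    case (Suc j)
    then show ?thesis using IH[of j] Suc.prems(3) unfolding eq by simp
  qed
qed simp


definition odd_harm :: "nat \<Rightarrow> real" where
  "odd_harm n = (\<Sum>i\<le>n. 1 / real (2 * i + 1))"

lemma odd_harm_approx_le: "odd_harm_approx n \<le> 1000000000 * odd_harm n"
proof -
  have "real_of_int (1000000000 div (2 * int i + 1)) \<le> 1000000000 * (1 / real (2 * i + 1))" for i
    using floor_divide_of_int_eq[of 1000000000 "2 * int i + 1", where ?'a = real]
      of_int_floor_le[of "1000000000 / real_of_int (2 * int i + 1)"] by (simp add: add.commute)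
  then show ?thesis
    unfolding odd_harm_approx_def odd_harm_def sum_distrib_left of_int_sum by (intro sum_mono)
qed

text \<open>Summing a convolution over its index replaces one factor by its partial sums, here
  \<open>odd_harm\<close>.\<close>

lemma sum_lower_coeff:
  "(\<Sum>n\<le>N. lower_coeff s n)
    = (1 - s) * (\<Sum>k\<le>N. bin_coeff s k * odd_harm (N - k)) - (\<Sum>k\<le>N. bin_coeff s k * (2 * real k + 1 - s))"
proof (induction N)
  case 0
  then show ?case by (simp add: lower_coeff_def odd_harm_def)
next
  case (Suc N)
  have "(\<Sum>k\<le>N. bin_coeff s k * odd_harm (Suc N - k))
    = (\<Sum>k\<le>N. bin_coeff s k * odd_harm (N - k)) + (\<Sum>k\<le>N. bin_coeff s k / real (2 * (Suc N - k) + 1))"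
    unfolding sum.distrib[symmetric]
    by (intro sum.cong refl) (simp add: odd_harm_def Suc_diff_le distrib_left)
  moreover have "bin_coeff s (Suc N) * odd_harm (Suc N - Suc N)
      = bin_coeff s (Suc N) / real (2 * (Suc N - Suc N) + 1)"
    by (simp add: odd_harm_def)
  ultimately have "(\<Sum>k\<le>Suc N. bin_coeff s k * odd_harm (Suc N - k))
    = (\<Sum>k\<le>N. bin_coeff s k * odd_harm (N - k))
      + (\<Sum>k\<le>Suc N. bin_coeff s k / real (2 * (Suc N - k) + 1))"
    unfolding sum.atMost_Suc by (simp only: add.assoc)
  then show ?case
    using Suc.IH unfolding sum.atMost_Suc[of "lower_coeff s"] lower_coeff_def[of s "Suc N"]
    by (simp add: distrib_left del: bin_coeff.simps)
qed

lemma bin_coeff_approx_76_bounds: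
  assumes "i < 76"
  shows "bin_coeff_approx 76 0 500000000 ! i \<le> 1000000000 * bin_coeff s1 i"
    "1000000000 * bin_coeff s1 i \<le> bin_coeff_approx 76 0 500000000 ! i + real i"
  using bin_coeff_approx_bounds[of 500000000 0 i 76] assms by simp_all

text \<open>The positive part is rounded down in both factors, and the negative part is rounded up
  through \<open>C ! i + i\<close>. The extra factor \<open>1000000000\<close> on the left matches
  the second scaled factor \<open>odd_harm_approx\<close> on the right.\<close>

lemma sum_lower_coeff_nonneg_lt_76:
  assumes "N < 76"
  shows "0 \<le> (\<Sum>n\<le>N. lower_coeff s1 n)"
proof (cases "N = 0")
  case True
  then show ?thesis by (simp add: lower_coeff_def)
next
  case False
  define C where "C = bin_coeff_approx 76 0 500000000"
  have len: "length C = 76" by (simp only: C_def length_bin_coeff_approx)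
  have bnd: "C ! i \<le> 1000000000 * bin_coeff s1 i" "1000000000 * bin_coeff s1 i \<le> C ! i + real i"
    if "i \<le> N" for i
    unfolding C_def using bin_coeff_approx_76_bounds[of i] that assms by auto
  have "76 = Suc 75" by simp
  then have "C ! 0 = 500000000" unfolding C_def by (simp only: bin_coeff_approx.simps nth_Cons_0)
  then have "1000000000 * (\<Sum>i\<le>N. (C ! i + int i) * (20000 * int i + 9091))
     \<le> 9091 * (\<Sum>i\<le>N. C ! i * odd_harm_approx (N - i))"
    using partial_sums_check_76 False assms
    by (intro partial_sums_check_sound[of C "tl C" "[1000000000]" 1 "500000000 * 9091"])
      (auto simp: C_def[symmetric] drop_Suc odd_harm_approx_def len)
  then have "real_of_int (1000000000 * (\<Sum>i\<le>N. (C ! i + int i) * (20000 * int i + 9091)))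
     \<le> real_of_int (9091 * (\<Sum>i\<le>N. C ! i * odd_harm_approx (N - i)))"
    by (simp only: of_int_le_iff)
  then have main: "1000000000 * (\<Sum>i\<le>N. (real_of_int (C ! i) + real i) * (20000 * real i + 9091))
     \<le> 9091 * (\<Sum>i\<le>N. real_of_int (C ! i) * real_of_int (odd_harm_approx (N - i)))"
    by (simp add: of_int_sum)
  have "(\<Sum>i\<le>N. 1000000000 * bin_coeff s1 i * (20000 * real i + 9091))
      \<le> (\<Sum>i\<le>N. (real_of_int (C ! i) + real i) * (20000 * real i + 9091))"
    using bnd(2) by (intro sum_mono mult_right_mono) auto
  moreover have "(\<Sum>i\<le>N. real_of_int (C ! i) * real_of_int (odd_harm_approx (N - i)))
      \<le> (\<Sum>i\<le>N. 1000000000 * bin_coeff s1 i * (1000000000 * odd_harm (N - i)))"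
  proof (intro sum_mono)
    fix i assume "i \<in> {..N}"
    then have "real_of_int (C ! i) * real_of_int (odd_harm_approx (N - i))
        \<le> 1000000000 * bin_coeff s1 i * real_of_int (odd_harm_approx (N - i))"
      using bnd(1)[of i] by (intro mult_right_mono) (auto simp: odd_harm_approx_def pos_imp_zdiv_nonneg_iff intro!: sum_nonneg)
    also have "\<dots> \<le> 1000000000 * bin_coeff s1 i * (1000000000 * odd_harm (N - i))"
      using bin_coeff_pos[of s1 i] odd_harm_approx_le by (intro mult_left_mono) auto
    finally show "real_of_int (C ! i) * real_of_int (odd_harm_approx (N - i))
        \<le> 1000000000 * bin_coeff s1 i * (1000000000 * odd_harm (N - i))" .
  qed
  ultimately have "1000000000 * (\<Sum>i\<le>N. 1000000000 * bin_coeff s1 i * (20000 * real i + 9091))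
     \<le> 9091 * (\<Sum>i\<le>N. 1000000000 * bin_coeff s1 i * (1000000000 * odd_harm (N - i)))"
    using main by linarith
  also have "(\<Sum>i\<le>N. 1000000000 * bin_coeff s1 i * (20000 * real i + 9091))
      = 10000000000000 * (\<Sum>i\<le>N. bin_coeff s1 i * (2 * real i + 1 - s1))"
    unfolding sum_distrib_left by (intro sum.cong refl) (simp add: algebra_simps)
  also have "(\<Sum>i\<le>N. 1000000000 * bin_coeff s1 i * (1000000000 * odd_harm (N - i)))
      = 1000000000000000000 * (\<Sum>i\<le>N. bin_coeff s1 i * odd_harm (N - i))"
    unfolding sum_distrib_left by (intro sum.cong refl) simp
  finally show ?thesis unfolding sum_lower_coeff by simp
qed

text \<open>Bounding each \<open>1 / (2 * (n - k) + 1)\<close> below by \<open>1 / (2 * n + 1)\<close> reduces the claim to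
  a comparison of the sum of the coefficients with \<open>y n\<close>, which decreases in \<open>n\<close>.\<close>

lemma lower_coeff_nonneg_ge_75:
  assumes "75 \<le> n"
  shows "0 \<le> lower_coeff s1 n"
proof -
  define y where "y = (\<lambda>n. bin_coeff s1 n * (2 * real n + 1 - s1) * (2 * real n + 1))"
  note pos = bin_coeff_pos[of s1]
  have "y n \<le> y 75" using assms
  proof (induction n rule: dec_induct)
    case (step n)
    have "y (Suc n) = bin_coeff s1 n * ((2 * real n + 1 - s1) *
        ((2 * real n + 2 - s1) * (2 * real n + 3 - s1) / (2 * real n + 4)))"
      by (simp add: y_def divide_simps) (simp add: algebra_simps)
    also have "\<dots> \<le> bin_coeff s1 n * ((2 * real n + 1 - s1) * (2 * real n + 1))"
    proof (intro mult_left_mono)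
      \<comment> \<open>Right minus left is \<open>4 * s1 * n - 2 + 5 * s1 - s1\<^sup>2\<close>,
        which is positive for these \<open>n\<close>.\<close>
      have "(2 * real n + 2 - s1) * (2 * real n + 3 - s1) \<le> (2 * real n + 1) * (2 * real n + 4)"
        using step.hyps by (simp add: algebra_simps)
      then show "(2 * real n + 2 - s1) * (2 * real n + 3 - s1) / (2 * real n + 4) \<le> 2 * real n + 1"
        by (simp add: pos_divide_le_eq)
    qed (use pos[of n] in auto)
    also have "\<dots> = y n" by (simp add: y_def)
    finally show ?case using step.IH by simp
  qed simp
  also have "y 75 \<le> (1 - s1) * (\<Sum>k\<le>75. bin_coeff s1 k)"
  proof -
    define C where "C = bin_coeff_approx 76 0 500000000"
    have len: "length C = 76" by (simp only: C_def length_bin_coeff_approx)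
    then have "last C = C ! 75" by (subst last_conv_nth) auto
    moreover have "sum_list C = (\<Sum>k\<le>75. C ! k)"
      unfolding sum_list_sum_nth len by (intro sum.cong) auto
    ultimately have "(C ! 75 + 75) * (1500000 + 9091) * 151 \<le> 9091 * (\<Sum>k\<le>75. C ! k)"
      using sum_bin_coeff_approx_ge by (simp add: C_def Let_def)
    then have "real_of_int ((C ! 75 + 75) * (1500000 + 9091) * 151) \<le> real_of_int (9091 * (\<Sum>k\<le>75. C ! k))"
      by (simp only: of_int_le_iff)
    then have sum_C: "(real_of_int (C ! 75) + 75) * (1509091 * 151) \<le> 9091 * (\<Sum>k\<le>75. real_of_int (C ! k))"
      by (simp add: of_int_sum)
    have "1000000000 * bin_coeff s1 75 * (1509091 * 151) \<le> (real_of_int (C ! 75) + 75) * (1509091 * 151)"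
      using bin_coeff_approx_76_bounds(2)[of 75] unfolding C_def by (intro mult_right_mono) auto
    also note sum_C
    also have "9091 * (\<Sum>k\<le>75. real_of_int (C ! k)) \<le> 9091 * (\<Sum>k\<le>75. 1000000000 * bin_coeff s1 k)"
      unfolding C_def by (intro mult_left_mono sum_mono bin_coeff_approx_76_bounds(1)) auto
    also have "\<dots> = 1000000000 * (9091 * (\<Sum>k\<le>75. bin_coeff s1 k))"
      by (simp only: sum_distrib_left mult.left_commute)
    finally have "bin_coeff s1 75 * (1509091 * 151) \<le> 9091 * (\<Sum>k\<le>75. bin_coeff s1 k)"
      by (simp only: mult.assoc mult_le_cancel_left_pos zero_less_numeral)
    then show ?thesis by (simp add: y_def)
  qed
  also have "\<dots> \<le> (1 - s1) * ((2 * real n + 1) * (\<Sum>k\<le>n. bin_coeff s1 k / real (2 * (n - k) + 1)))"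
  proof (intro mult_left_mono)
    have "(\<Sum>k\<le>75. bin_coeff s1 k) \<le> (\<Sum>k\<le>n. bin_coeff s1 k)"
      using assms pos by (intro sum_mono2) (auto intro: less_imp_le)
    also have "\<dots> \<le> (\<Sum>k\<le>n. (2 * real n + 1) * (bin_coeff s1 k / real (2 * (n - k) + 1)))"
    proof (intro sum_mono)
      fix k assume "k \<in> {..n}"
      then have "bin_coeff s1 k * real (2 * (n - k) + 1) \<le> bin_coeff s1 k * (2 * real n + 1)"
        using pos[of k] by (intro mult_left_mono) (auto simp: of_nat_diff)
      then show "bin_coeff s1 k \<le> (2 * real n + 1) * (bin_coeff s1 k / real (2 * (n - k) + 1))"
        by (simp add: pos_le_divide_eq mult.commute)
    qed
    finally show "(\<Sum>k\<le>75. bin_coeff s1 k)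
        \<le> (2 * real n + 1) * (\<Sum>k\<le>n. bin_coeff s1 k / real (2 * (n - k) + 1))"
      by (simp add: sum_distrib_left)
  qed simp
  finally have "(2 * real n + 1) * (bin_coeff s1 n * (2 * real n + 1 - s1))
      \<le> (2 * real n + 1) * ((1 - s1) * (\<Sum>k\<le>n. bin_coeff s1 k / real (2 * (n - k) + 1)))"
    by (simp only: y_def mult_ac)
  then have "bin_coeff s1 n * (2 * real n + 1 - s1) \<le> (1 - s1) * (\<Sum>k\<le>n. bin_coeff s1 k / real (2 * (n - k) + 1))"
    by (subst (asm) mult_le_cancel_left_pos) auto
  then show ?thesis by (simp only: lower_coeff_def)
qed

lemma sum_lower_coeff_nonneg: "0 \<le> (\<Sum>n\<le>N. lower_coeff s1 n)"
proof (cases "N < 76")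
  case False
  then have "75 \<le> N" by simp
  then show ?thesis
  proof (induction N rule: dec_induct)
    case base
    show ?case by (rule sum_lower_coeff_nonneg_lt_76) simp
  next
    case (step n)
    then show ?case using lower_coeff_nonneg_ge_75[of "Suc n"] by simp
  qed
qed (rule sum_lower_coeff_nonneg_lt_76)

lemma log_mean_le_lambda_mean_s1:
  assumes "0 < a" "0 < b"
  shows "log_mean a b \<le> lambda_mean s1 a b"
proof (cases "a = b")
  case False
  show ?thesis
  proof (rule means_reduce[OF assms False])
    show "log_mean b a \<le> lambda_mean s1 b a"
      if "log_mean a b \<le> lambda_mean s1 a b" "0 < a" "0 < b" for a b
      using that lambda_mean_commute log_mean_commute by metis
    show "log_mean (k * a) (k * b) \<le> lambda_mean s1 (k * a) (k * b)"
      if "log_mean a b \<le> lambda_mean s1 a b" "0 < k" "0 < a" "0 < b" for k a b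
      using that by (simp add: lambda_mean_scale log_mean_scale)
    show "log_mean (1 - t) (1 + t) \<le> lambda_mean s1 (1 - t) (1 + t)" if "0 < t" "t < 1" for t
      using that by (intro log_mean_le_lambda_mean_unit sum_lower_coeff_nonneg) auto
  qed
qed (simp add: lambda_mean_def log_mean_def)

text \<open>The witnesses \<open>2 ^ 12\<close> and \<open>3 ^ 12\<close> have rational twelfth roots.\<close>

lemma ex_lambda_mean_less_log_mean: "\<exists>a b. 0 < a \<and> 0 < b \<and> lambda_mean (1/12) a b < log_mean a b"
proof -
  \<comment> \<open>The aim is \<open>ln (3/2) \<le> 0.4064\<close>; a quarter of the exponent is
    small enough for the quadratic Taylor bound.\<close>
  have "(3/2 :: real) \<le> exp (4 * 0.1016)"
  proof -
    have "(3/2 :: real) \<le> (1 + 0.1016 + 0.1016\<^sup>2 / 2) ^ 4" by (simp add: power2_eq_square eval_nat_numeral)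
    also have "\<dots> \<le> exp 0.1016 ^ 4"
      by (intro power_mono exp_lower_Taylor_quadratic) auto
    also have "\<dots> = exp (4 * 0.1016)" by (simp flip: exp_of_nat_mult)
    finally show ?thesis .
  qed
  then have "ln (3/2 :: real) \<le> ln (exp (4 * 0.1016))" by (intro ln_mono) auto
  then have ln_le: "ln (3/2 :: real) \<le> 0.4064" by simp
  have ln_pos: "0 < ln (3/2 :: real)" by simp
  have "ln (531441::real) - ln 4096 = ln (531441 / 4096)" by (simp add: ln_div)
  also have "\<dots> = ln ((3/2) ^ 12)" by (simp add: power_divide)
  also have "\<dots> = 12 * ln (3/2)" by (subst ln_realpow) auto
  finally have "log_mean 4096 531441 = 527345 / (12 * ln (3/2))"
    by (simp add: log_mean_def)
  also have "\<dots> \<ge> 527345 / (12 * 0.4064)"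
    using ln_le ln_pos by (intro divide_left_mono mult_left_mono mult_pos_pos) auto
  finally have L: "527345 / (12 * 0.4064) \<le> log_mean 4096 531441" .
  \<comment> \<open>The twelfth root of the midpoint is the only irrational quantity left in
    \<open>lambda_mean\<close>; four decimals suffice.\<close>
  define w :: real where "w = (535537/2) powr (1/12)"
  have "w > 0" by (simp add: w_def)
  have w12: "w ^ 12 = 535537/2" by (simp add: w_def powr_power)
  have "2.8334 ^ 12 < w ^ 12" unfolding w12 by (simp add: power_divide)
  then have w_gt: "2.8334 < w" by (rule power_less_imp_less_base) (use \<open>w > 0\<close> in simp)
  have "w ^ 12 < 2.8335 ^ 12" unfolding w12 by (simp add: power_divide)
  then have w_less: "w < 2.8335" by (rule power_less_imp_less_base) simp
  have p2: "4096 powr (1/12) = (2::real)" "531441 powr (1/12) = (3::real)"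
    using powr_powr[of 2 12 "1/12"] powr_powr[of 3 12 "1/12"] by simp_all
  have p: "x powr (13/12) = x * x powr (1/12)" if "x > 0" for x :: real
    using that powr_add[of x 1 "1/12"] by simp
  have "lambda_mean (1/12) 4096 531441 = - 11 / 13 * ((1602515 - 535537 * w) / (5 - 2 * w))"
    using p[of 4096] p[of 531441] p[of "535537/2"]
    by (simp add: lambda_mean_def p2 w_def[symmetric])
  also have "\<dots> < 527345 / (12 * 0.4064)"
    using w_gt w_less by (simp add: divide_simps)
  also note L
  finally show ?thesis by (intro exI[of _ 4096] exI[of _ 531441]) auto
qed

text \<open>The open interval \<open>(0, 1)\<close> avoids the exceptional branches, and the
  denominator is a nonzero multiple of a positive midpoint gap.\<close>

lemma isCont_lambda_mean:
  assumes "0 < a" "0 < b" "0 < s" "s < 1"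
  shows "isCont (\<lambda>s. lambda_mean s a b) s"
proof (cases "a = b")
  case True
  then show ?thesis by (simp add: lambda_mean_def)
next
  case False
  define g where "g = (\<lambda>s. (s - 1) / (s + 1) *
       ((a powr (s + 1) + b powr (s + 1) - 2 * ((a + b) / 2) powr (s + 1)) /
        (a powr s + b powr s - 2 * ((a + b) / 2) powr s)))"
  have "a powr s + b powr s - 2 * ((a + b) / 2) powr s \<noteq> 0"
  proof -
    have "mid_gap (pot s) a b = (a powr s + b powr s - 2 * ((a + b) / 2) powr s) / (s * (s - 1))"
      using assms by (simp add: mid_gap_def pot_def add_divide_distrib diff_divide_distrib)
    then show ?thesis using mid_gap_pot_pos[OF assms(1,2) False, of s] by auto
  qed
  then have "isCont g s"
    unfolding g_def using assms by (intro continuous_intros) auto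
  moreover have "\<forall>\<^sub>F r in nhds s. r \<in> {0<..<1}"
    using assms by (intro eventually_nhds_in_open) auto
  then have "\<forall>\<^sub>F r in nhds s. lambda_mean r a b = g r"
    by eventually_elim (use False in \<open>auto simp: lambda_mean_def g_def\<close>)
  ultimately show ?thesis by (simp add: isCont_cong)
qed

section \<open>The critical parameter\<close>

theorem theorem3:
  shows "\<exists>s0::real. 1/12 < s0 \<and> s0 < 1/11 \<and>
    (\<forall>s. s0 \<le> s \<and> s \<le> 1 \<longrightarrow>
       (\<forall>a b::real. 0 < a \<longrightarrow> 0 < b \<longrightarrow>
          log_mean a b \<le> lambda_mean s a b \<and> lambda_mean s a b \<le> identric_mean a b)) \<and>
    (\<forall>s. (\<forall>a b::real. 0 < a \<longrightarrow> 0 < b \<longrightarrow> log_mean a b \<le> lambda_mean s a b)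
            \<longleftrightarrow> s0 \<le> s) \<and>
    (\<forall>s. (\<forall>a b::real. 0 < a \<longrightarrow> 0 < b \<longrightarrow> lambda_mean s a b \<le> identric_mean a b)
            \<longleftrightarrow> s \<le> 1)"
proof -
  define S where "S = {s. \<forall>a b. 0 < a \<longrightarrow> 0 < b \<longrightarrow> log_mean a b \<le> lambda_mean s a b}"
  have up: "r \<in> S" if "s \<in> S" "s \<le> r" for r s
    using that lambda_mean_mono[OF _ _ that(2)] unfolding S_def by (blast intro: order_trans)
  have s1: "s1 \<in> S" using log_mean_le_lambda_mean_s1 by (simp add: S_def)
  \<comment> \<open>A strict failure at one pair persists for slightly larger parameters. This gives
    both the strict bound \<open>1/12 < s0\<close> and \<open>s0 \<in> S\<close>.\<close>
  have not_in: "\<exists>r>s. r \<notin> S" if "0 < s" "s < 1" "s \<notin> S" for s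
  proof -
    obtain a b where ab: "0 < a" "0 < b" "lambda_mean s a b < log_mean a b"
      using \<open>s \<notin> S\<close> by (auto simp: S_def not_le)
    have "((\<lambda>s. lambda_mean s a b) \<longlongrightarrow> lambda_mean s a b) (at_right s)"
      using isCont_lambda_mean[OF ab(1,2) that(1,2)] by (auto simp: isCont_def intro: tendsto_mono at_le)
    from order_tendstoD(2)[OF this ab(3)]
    have "\<forall>\<^sub>F r in at_right s. lambda_mean r a b < log_mean a b" .
    then have "\<forall>\<^sub>F r in at_right s. lambda_mean r a b < log_mean a b \<and> s < r"
      by (intro eventually_conj eventually_at_right_less)
    from eventually_happens'[OF trivial_limit_at_right_real this]
    show ?thesis using ab by (auto simp: S_def not_le)
  qed
  have "1/12 \<notin> S"
    using ex_lambda_mean_less_log_mean by (auto simp: S_def not_le)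
  then obtain r where r: "1/12 < r" "r \<notin> S" using not_in[of "1/12"] by auto
  have r_le: "r \<le> s" if "s \<in> S" for s using up[OF that, of r] r(2) by force
  define s0 where "s0 = Inf S"
  have bdd: "bdd_below S" using r_le by (rule bdd_belowI)
  have "r \<le> s0" unfolding s0_def using s1 r_le by (intro cInf_greatest) auto
  then have gt: "1/12 < s0" using r by simp
  have "s0 \<le> s1" unfolding s0_def using s1 bdd by (rule cInf_lower)
  then have lt: "s0 < 1/11" by simp
  have "s0 \<in> S"
  proof (rule ccontr)
    assume "s0 \<notin> S"
    then obtain q where q: "s0 < q" "q \<notin> S" using not_in[of s0] gt lt by auto
    then obtain s where "s \<in> S" "s < q"
      using cInf_lessD[of S q] s1 unfolding s0_def by blast
    then show False using up[of s q] q(2) by simp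
  qed
  then have iff: "s \<in> S \<longleftrightarrow> s0 \<le> s" for s
    using up[of s0 s] cInf_lower[OF _ bdd, of s] unfolding s0_def by blast
  have "s \<le> 1" if "\<And>a b. 0 < a \<Longrightarrow> 0 < b \<Longrightarrow> lambda_mean s a b \<le> identric_mean a b" for s
  proof (rule ccontr)
    assume "\<not> s \<le> 1"
    \<comment> \<open>The cap at 3/2 meets the range of \<open>ex_identric_mean_less\<close>;
      monotonicity carries the failure back to \<open>s\<close>.\<close>
    then have "1 < min s (3/2)" "min s (3/2) < 2" by (auto simp: min_def)
    then obtain a b where ab: "0 < a" "0 < b" "identric_mean a b < lambda_mean (min s (3/2)) a b"
      using ex_identric_mean_less by blast
    have "lambda_mean (min s (3/2)) a b \<le> lambda_mean s a b"
      using ab(1,2) by (rule lambda_mean_mono) simp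
    then show False using that[OF ab(1,2)] ab(3) by linarith
  qed
  then have "(\<forall>a b. 0 < a \<longrightarrow> 0 < b \<longrightarrow> lambda_mean s a b \<le> identric_mean a b) \<longleftrightarrow> s \<le> 1" for s
    using lambda_mean_le_identric_mean by blast
  moreover have "(\<forall>a b. 0 < a \<longrightarrow> 0 < b \<longrightarrow> log_mean a b \<le> lambda_mean s a b) \<longleftrightarrow> s0 \<le> s" for s
    using iff[of s] by (simp add: S_def)
  ultimately show ?thesis using gt lt by (intro exI[of _ s0]) blast
qed

end
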